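(* Let $p$ be an odd prime, $k\ge 1$, $n\ge 2$, $m=n-1$, let $V=\mathbb{F}_{p^k}^n$ with canonical basis $e_1,\dots,e_n$, and let $q$ be a fixed non-square element of $\mathbb{F}_{p^k}^\times$. Let $(V,+,\cdot_1)$ and $(V,+,\cdot_2)$ be two commutative, $3$-nilpotent $\mathbb{F}_{p^k}$-algebras with $V\cdot_1 V=V\cdot_2 V=\mathrm{span}\{e_n\}$, and such that the annihilator of each of the two algebras is also $\mathrm{span}\{e_n\}$. Let $\Theta^1,\Theta^2$ be their defining matrices. Let $A\in GL(m,p^k)$ and $l\in\{1,q\}$, and let $$M=\begin{pmatrix} A & 0\\ 0 & l\end{pmatrix}.$$ Then $M$ is an isomorphism between the two algebras, in the sense that $(xM)\cdot_1(yM)=(x\cdot_2 y)M$ for all $x,y\in V$, if and only if $$A\,\Theta^1A^{tr}=l\,\Theta^2 .$$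
   Context: Elements of $V$ are row vectors and matrices act on the right, $x\mapsto xM$. Algebras are associative, not necessarily unital, with $\mathbb{F}_{p^k}$-bilinear product; "$3$-nilpotent" means $x\cdot y\cdot z=0$ for all $x,y,z$. $V\cdot V$ is the span of all products and $\mathrm{Ann}(V)=\{a\in V\mid a\cdot x=0 \text{ for all } x\in V\}$. $GL(m,p^k)$ is the group of invertible $m\times m$ matrices over $\mathbb{F}_{p^k}$. For such an algebra with $V\cdot V=\mathrm{Ann}(V)=\mathrm{span}\{e_n\}$, the defining matrix $\Theta$ is the $(n-1)\times(n-1)$ matrix over $\mathbb{F}_{p^k}$ whose entries $\Theta_{i,j}$ are given by $e_i\cdot e_j=\Theta_{i,j}\,e_n$ for $1\le i,j\le n-1$. $A^{tr}$ denotes the transpose. *)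

theory Defs
  imports
    "HOL-Library.Cardinality"
    "HOL-Computational_Algebra.Primes"
    "Jordan_Normal_Form.Matrix"
    "Jordan_Normal_Form.VS_Connect"
begin

text \<open>
  The space of row vectors is \<open>carrier_vec n\<close>; the basis vectors \<open>e_1, ..., e_n\<close> are
  \<open>unit_vec n 0, ..., unit_vec n (n - 1)\<close>, so indices are shifted down by one. Products are
  curried functions on \<^typ>\<open>'a vec\<close> of which only the restriction to \<open>carrier_vec n\<close> matters.
\<close>

abbreviation vec_span :: "nat \<Rightarrow> 'a::field vec set \<Rightarrow> 'a vec set" where
  "vec_span n S \<equiv> LinearCombinations.module.span class_ring (module_vec TYPE('a) n) S"

definition vec_mult_mat :: "'a::semiring_0 vec \<Rightarrow> 'a mat \<Rightarrow> 'a vec" (infixl "\<^sub>v*" 70) where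
  "x \<^sub>v* M = vec (dim_col M) (\<lambda>j. x \<bullet> col M j)"

locale vec_algebra =
  fixes n :: nat and mul :: "'a::field vec \<Rightarrow> 'a vec \<Rightarrow> 'a vec"
  assumes mul_closed: "\<lbrakk>x \<in> carrier_vec n; y \<in> carrier_vec n\<rbrakk> \<Longrightarrow> mul x y \<in> carrier_vec n"
    and mul_add_left: "\<lbrakk>x \<in> carrier_vec n; y \<in> carrier_vec n; z \<in> carrier_vec n\<rbrakk>
      \<Longrightarrow> mul (x + y) z = mul x z + mul y z"
    and mul_add_right: "\<lbrakk>x \<in> carrier_vec n; y \<in> carrier_vec n; z \<in> carrier_vec n\<rbrakk>
      \<Longrightarrow> mul x (y + z) = mul x y + mul x z"
    and mul_smult_left: "\<lbrakk>x \<in> carrier_vec n; y \<in> carrier_vec n\<rbrakk>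
      \<Longrightarrow> mul (c \<cdot>\<^sub>v x) y = c \<cdot>\<^sub>v mul x y"
    and mul_smult_right: "\<lbrakk>x \<in> carrier_vec n; y \<in> carrier_vec n\<rbrakk>
      \<Longrightarrow> mul x (c \<cdot>\<^sub>v y) = c \<cdot>\<^sub>v mul x y"
    and mul_assoc: "\<lbrakk>x \<in> carrier_vec n; y \<in> carrier_vec n; z \<in> carrier_vec n\<rbrakk>
      \<Longrightarrow> mul (mul x y) z = mul x (mul y z)"

definition commutative_on_vec :: "nat \<Rightarrow> ('a vec \<Rightarrow> 'a vec \<Rightarrow> 'a vec) \<Rightarrow> bool" where
  "commutative_on_vec n mul \<longleftrightarrow>
    (\<forall>x \<in> carrier_vec n. \<forall>y \<in> carrier_vec n. mul x y = mul y x)"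

definition three_nilpotent :: "nat \<Rightarrow> ('a::zero vec \<Rightarrow> 'a vec \<Rightarrow> 'a vec) \<Rightarrow> bool" where
  "three_nilpotent n mul \<longleftrightarrow>
    (\<forall>x \<in> carrier_vec n. \<forall>y \<in> carrier_vec n. \<forall>z \<in> carrier_vec n. mul (mul x y) z = 0\<^sub>v n)"

definition algebra_square :: "nat \<Rightarrow> ('a::field vec \<Rightarrow> 'a vec \<Rightarrow> 'a vec) \<Rightarrow> 'a vec set" where
  "algebra_square n mul = vec_span n {mul x y | x y. x \<in> carrier_vec n \<and> y \<in> carrier_vec n}"

definition annihilator :: "nat \<Rightarrow> ('a::zero vec \<Rightarrow> 'a vec \<Rightarrow> 'a vec) \<Rightarrow> 'a vec set" where
  "annihilator n mul = {a \<in> carrier_vec n. \<forall>x \<in> carrier_vec n. mul a x = 0\<^sub>v n}"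

definition is_defining_matrix ::
    "nat \<Rightarrow> ('a::field vec \<Rightarrow> 'a vec \<Rightarrow> 'a vec) \<Rightarrow> 'a mat \<Rightarrow> bool" where
  "is_defining_matrix n mul \<Theta> \<longleftrightarrow>
    \<Theta> \<in> carrier_mat (n - 1) (n - 1) \<and>
    (\<forall>i < n - 1. \<forall>j < n - 1.
      mul (unit_vec n i) (unit_vec n j) = \<Theta> $$ (i, j) \<cdot>\<^sub>v unit_vec n (n - 1))"

end

theory Submission
  imports Defs
begin

text \<open>
  The statement is the change-of-basis rule for Gram matrices of bilinear forms. Since the last
  basis vector \<open>e\<close> annihilates the algebra (on both sides, by commutativity) and all products
  of the remaining basis vectors are multiples of \<open>e\<close>, the product is a bilinear form with values
  in the line of \<open>e\<close>: it equals \<open>(x \<bullet> (G *\<^sub>v y)) \<cdot>\<^sub>v e\<close>, where \<open>G\<close> is the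
  defining matrix bordered by a zero row and a zero column. This is
  \<open>mul_eq_bilinear_form\<close>.

  The block matrix \<open>M\<close> sends \<open>e\<close> to \<open>l \<cdot>\<^sub>v e\<close>. Comparing the coefficients of \<open>e\<close>
  in \<open>(xM)(yM)\<close> and \<open>(xy)M\<close>, the homomorphism condition says that two bilinear forms agree,
  one with matrix \<open>M G\<^sub>1 M\<^sup>T\<close> and the other with matrix \<open>l G\<^sub>2\<close>. A bilinear form determines
  its matrix (\<open>bilinear_form_eq_iff\<close>), so the two matrices agree, and in the equation
  \<open>M G\<^sub>1 M\<^sup>T = l G\<^sub>2\<close> only the upper left block \<open>A \<Theta>\<^sub>1 A\<^sup>T = l \<Theta>\<^sub>2\<close> carries
  information.
\<close>

lemma vec_mult_mat_eq_transpose: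
  fixes M :: "'a::comm_semiring_0 mat"
  assumes "M \<in> carrier_mat r c" and "x \<in> carrier_vec r"
  shows "x \<^sub>v* M = transpose_mat M *\<^sub>v x"
  using assms
  by (intro eq_vecI) (auto simp: vec_mult_mat_def intro!: comm_scalar_prod[where n = r])

text \<open>
  Linear identities on \<open>carrier_vec n\<close> need to be checked on the canonical basis only. The
  induction clears the coordinates of a vector one at a time, from the last to the first.
\<close>

lemma unit_vec_induct [consumes 1, case_names zero unit add smult]:
  fixes x :: "'a::comm_ring_1 vec"
  assumes "x \<in> carrier_vec n"
    and zero: "P (0\<^sub>v n)"
    and unit: "\<And>i. i < n \<Longrightarrow> P (unit_vec n i)"
    and add: "\<And>u v. \<lbrakk>u \<in> carrier_vec n; v \<in> carrier_vec n; P u; P v\<rbrakk> \<Longrightarrow> P (u + v)"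
    and smult: "\<And>c u. \<lbrakk>u \<in> carrier_vec n; P u\<rbrakk> \<Longrightarrow> P (c \<cdot>\<^sub>v u)"
  shows "P x"
proof -
  have "P x" if "k \<le> n" "x \<in> carrier_vec n" "\<forall>i<n. k \<le> i \<longrightarrow> x $ i = 0" for k x
    using that
  proof (induction k arbitrary: x)
    case 0
    then have "x = 0\<^sub>v n" by (intro eq_vecI) auto
    then show ?case using zero by simp
  next
    case (Suc k)
    define y where "y = vec n (\<lambda>i. if i = k then 0 else x $ i)"
    have y: "y \<in> carrier_vec n" by (simp add: y_def)
    have "P y"
    proof (rule Suc.IH)
      show "\<forall>i<n. k \<le> i \<longrightarrow> y $ i = 0"
        using Suc.prems by (auto simp: y_def)
    qed (use Suc.prems y in auto)
    moreover have "P (x $ k \<cdot>\<^sub>v unit_vec n k)"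
      using Suc.prems by (intro smult unit) auto
    ultimately have "P (y + x $ k \<cdot>\<^sub>v unit_vec n k)"
      using y by (intro add) auto
    moreover have "y + x $ k \<cdot>\<^sub>v unit_vec n k = x"
      using Suc.prems by (intro eq_vecI) (auto simp: y_def)
    ultimately show ?case by simp
  qed
  from this[of n x] show ?thesis using assms(1) by auto
qed

lemma bilinear_form_eq_iff:
  fixes P Q :: "'a::comm_ring_1 mat"
  assumes P: "P \<in> carrier_mat n n" and Q: "Q \<in> carrier_mat n n"
  shows "(\<forall>x \<in> carrier_vec n. \<forall>y \<in> carrier_vec n. x \<bullet> (P *\<^sub>v y) = x \<bullet> (Q *\<^sub>v y)) \<longleftrightarrow> P = Q"
proof
  assume eq: "\<forall>x \<in> carrier_vec n. \<forall>y \<in> carrier_vec n. x \<bullet> (P *\<^sub>v y) = x \<bullet> (Q *\<^sub>v y)"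
  have entry: "unit_vec n i \<bullet> (R *\<^sub>v unit_vec n j) = R $$ (i, j)"
    if "R \<in> carrier_mat n n" "i < n" "j < n" for R :: "'a mat" and i j
    using that by (simp add: scalar_prod_left_unit[where n = n])
  show "P = Q"
  proof (rule eq_matI)
    fix i j assume "i < dim_row Q" "j < dim_col Q"
    then have "i < n" "j < n" using Q by auto
    then show "P $$ (i, j) = Q $$ (i, j)"
      using eq entry[OF P] entry[OF Q] by (metis unit_vec_carrier)
  qed (use P Q in auto)
qed simp

definition bordered_mat :: "'a::zero mat \<Rightarrow> 'a mat" where
  "bordered_mat \<Theta> = four_block_mat \<Theta>
     (0\<^sub>m (dim_row \<Theta>) 1) (0\<^sub>m 1 (dim_col \<Theta>)) (0\<^sub>m 1 1)"

lemma bordered_mat_carrier: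
  "\<Theta> \<in> carrier_mat r c \<Longrightarrow> bordered_mat \<Theta> \<in> carrier_mat (Suc r) (Suc c)"
  unfolding bordered_mat_def by auto

lemma bordered_mat_eq_iff:
  assumes P: "P \<in> carrier_mat r c" and Q: "Q \<in> carrier_mat r c"
  shows "bordered_mat P = bordered_mat Q \<longleftrightarrow> P = Q"
proof
  assume eq: "bordered_mat P = bordered_mat Q"
  show "P = Q"
  proof (rule eq_matI)
    fix i j assume ij: "i < dim_row Q" "j < dim_col Q"
    have "bordered_mat P $$ (i, j) = bordered_mat Q $$ (i, j)" using eq by simp
    then show "P $$ (i, j) = Q $$ (i, j)"
      using ij P Q by (simp add: bordered_mat_def)
  qed (use P Q in auto)
qed simp

lemma smult_bordered_mat:
  fixes \<Theta> :: "'a::semiring_0 mat"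
  shows "c \<cdot>\<^sub>m bordered_mat \<Theta> = bordered_mat (c \<cdot>\<^sub>m \<Theta>)"
  unfolding bordered_mat_def by (rule eq_matI) auto

text \<open>
  A block diagonal change of basis acts on the two blocks separately, so the border stays zero
  and the corner becomes \<open>l * 0 * l = 0\<close>. Hence \<open>l\<close> enters the final equation only through
  the image of the last basis vector.
\<close>

lemma block_diag_congruence_bordered_mat:
  fixes A \<Theta> :: "'a::comm_ring_1 mat"
  assumes A: "A \<in> carrier_mat m m" and \<Theta>: "\<Theta> \<in> carrier_mat m m"
    and M: "M = four_block_mat A (0\<^sub>m m 1) (0\<^sub>m 1 m) (mat 1 1 (\<lambda>_. l))"
  shows "M * bordered_mat \<Theta> * transpose_mat M = bordered_mat (A * \<Theta> * transpose_mat A)"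
proof -
  let ?L = "mat 1 1 (\<lambda>_. l) :: 'a mat"
  have MT: "transpose_mat M =
      four_block_mat (transpose_mat A) (0\<^sub>m m 1) (0\<^sub>m 1 m) (transpose_mat ?L)"
    unfolding M using A by (subst transpose_four_block_mat) auto
  have "M * bordered_mat \<Theta> = four_block_mat (A * \<Theta>) (0\<^sub>m m 1) (0\<^sub>m 1 m) (0\<^sub>m 1 1)"
    unfolding M bordered_mat_def using A \<Theta> by (subst mult_four_block_mat) auto
  also have "\<dots> * transpose_mat M =
      four_block_mat (A * \<Theta> * transpose_mat A) (0\<^sub>m m 1) (0\<^sub>m 1 m) (0\<^sub>m 1 1)"
    unfolding MT using A \<Theta> by (subst mult_four_block_mat) auto
  finally show ?thesis using A \<Theta> by (simp add: bordered_mat_def)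
qed

lemma transpose_block_diag_mult_last_unit_vec:
  fixes A :: "'a::comm_ring_1 mat"
  assumes A: "A \<in> carrier_mat m m"
    and M: "M = four_block_mat A (0\<^sub>m m 1) (0\<^sub>m 1 m) (mat 1 1 (\<lambda>_. l))"
  shows "transpose_mat M *\<^sub>v unit_vec (Suc m) m = l \<cdot>\<^sub>v unit_vec (Suc m) m"
  unfolding M using A
  by (intro eq_vecI) (auto simp: scalar_prod_right_unit[where n = "Suc m"])

lemma (in vec_algebra) mul_zero_left:
  assumes "y \<in> carrier_vec n"
  shows "mul (0\<^sub>v n) y = 0\<^sub>v n"
proof -
  have "mul (0 \<cdot>\<^sub>v 0\<^sub>v n) y = 0 \<cdot>\<^sub>v mul (0\<^sub>v n) y"
    using assms by (intro mul_smult_left) auto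
  moreover have "(0 :: 'a) \<cdot>\<^sub>v 0\<^sub>v n = 0\<^sub>v n"
    by (intro eq_vecI) auto
  moreover have "(0 :: 'a) \<cdot>\<^sub>v mul (0\<^sub>v n) y = 0\<^sub>v n"
    using mul_closed[of "0\<^sub>v n" y] assms by (intro eq_vecI) auto
  ultimately show ?thesis by simp
qed

lemma (in vec_algebra) mul_zero_right:
  assumes "x \<in> carrier_vec n"
  shows "mul x (0\<^sub>v n) = 0\<^sub>v n"
proof -
  have "mul x (0 \<cdot>\<^sub>v 0\<^sub>v n) = 0 \<cdot>\<^sub>v mul x (0\<^sub>v n)"
    using assms by (intro mul_smult_right) auto
  moreover have "(0 :: 'a) \<cdot>\<^sub>v 0\<^sub>v n = 0\<^sub>v n"
    by (intro eq_vecI) auto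
  moreover have "(0 :: 'a) \<cdot>\<^sub>v mul x (0\<^sub>v n) = 0\<^sub>v n"
    using mul_closed[of x "0\<^sub>v n"] assms by (intro eq_vecI) auto
  ultimately show ?thesis by simp
qed

text \<open>
  Both sides are bilinear, so it suffices to compare them on basis vectors. There the
  defining matrix gives the product unless one factor is the last basis vector; in that case
  the product is zero, which is what the border encodes.
\<close>

lemma (in vec_algebra) mul_eq_bilinear_form:
  assumes n: "n = Suc m"
    and comm: "commutative_on_vec n mul"
    and ann: "unit_vec n m \<in> annihilator n mul"
    and def: "is_defining_matrix n mul \<Theta>"
    and x: "x \<in> carrier_vec n" and y: "y \<in> carrier_vec n"
  shows "mul x y = (x \<bullet> (bordered_mat \<Theta> *\<^sub>v y)) \<cdot>\<^sub>v unit_vec n m"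
proof -
  have \<Theta>: "\<Theta> \<in> carrier_mat m m"
    and prod: "\<And>i j. \<lbrakk>i < m; j < m\<rbrakk> \<Longrightarrow>
      mul (unit_vec n i) (unit_vec n j) = \<Theta> $$ (i, j) \<cdot>\<^sub>v unit_vec n m"
    using def n by (auto simp: is_defining_matrix_def)
  let ?G = "bordered_mat \<Theta>"
  have G: "?G \<in> carrier_mat n n" using bordered_mat_carrier[OF \<Theta>] n by simp
  have ann_left: "mul (unit_vec n m) v = 0\<^sub>v n" if "v \<in> carrier_vec n" for v
    using ann that by (auto simp: annihilator_def)
  have ann_right: "mul v (unit_vec n m) = 0\<^sub>v n" if "v \<in> carrier_vec n" for v
    using ann_left[OF that] comm that by (simp add: commutative_on_vec_def)
  have basis: "mul (unit_vec n i) (unit_vec n j) = ?G $$ (i, j) \<cdot>\<^sub>v unit_vec n m"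
    if "i < n" "j < n" for i j
  proof (cases "i < m \<and> j < m")
    case True
    then show ?thesis using prod \<Theta> by (simp add: bordered_mat_def)
  next
    case False
    then have "i = m \<or> j = m" using that n by auto
    then have "mul (unit_vec n i) (unit_vec n j) = 0\<^sub>v n"
      using ann_left ann_right by auto
    moreover have "?G $$ (i, j) = 0"
      using \<open>i = m \<or> j = m\<close> that n \<Theta> by (auto simp: bordered_mat_def)
    ultimately show ?thesis by (auto intro!: eq_vecI)
  qed
  have basis_left: "mul (unit_vec n i) y = (unit_vec n i \<bullet> (?G *\<^sub>v y)) \<cdot>\<^sub>v unit_vec n m"
    if i: "i < n" for i
    using y
  proof (induction y rule: unit_vec_induct)
    case zero
    have "?G *\<^sub>v 0\<^sub>v n = 0\<^sub>v n" using G by (intro eq_vecI) auto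
    then show ?case using i by (auto simp: mul_zero_right intro!: eq_vecI)
  next
    case (unit j)
    then show ?case using basis[OF i unit] G i by (simp add: scalar_prod_left_unit[where n = n])
  next
    case (add u v)
    then show ?case using G i
      by (simp add: mul_add_right mult_add_distrib_mat_vec[where nr = n and nc = n]
          scalar_prod_add_distrib[where n = n] add_smult_distrib_vec)
  next
    case (smult c u)
    then show ?case using G i
      by (simp add: mul_smult_right mult_mat_vec[where nr = n and nc = n] smult_smult_assoc)
  qed
  have Gy: "?G *\<^sub>v y \<in> carrier_vec n" using G y by simp
  show ?thesis using x
  proof (induction x rule: unit_vec_induct)
    case zero
    then show ?case using y Gy by (auto simp: mul_zero_left intro!: eq_vecI)
  next
    case (unit i)
    then show ?case by (rule basis_left)
  next
    case (add u v)
    then show ?case using y Gy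
      by (simp add: mul_add_left add_scalar_prod_distrib[where n = n] add_smult_distrib_vec)
  next
    case (smult c u)
    then show ?case using y Gy by (simp add: mul_smult_left smult_smult_assoc)
  qed
qed

theorem theorem4p10:
  fixes p k n m :: nat
    and q l :: "'a::{field,finite}"
    and mul1 mul2 :: "'a vec \<Rightarrow> 'a vec \<Rightarrow> 'a vec"
    and \<Theta>1 \<Theta>2 A M :: "'a mat"
  assumes "prime p" and "odd p" and "k \<ge> 1" and "CARD('a) = p ^ k"
    and "n \<ge> 2" and "m = n - 1"
    and "q \<noteq> 0" and "\<not> (\<exists>r. q = r\<^sup>2)"
    and "vec_algebra n mul1" and "vec_algebra n mul2"
    and "commutative_on_vec n mul1" and "commutative_on_vec n mul2"
    and "three_nilpotent n mul1" and "three_nilpotent n mul2"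
    and "algebra_square n mul1 = vec_span n {unit_vec n (n - 1)}"
    and "algebra_square n mul2 = vec_span n {unit_vec n (n - 1)}"
    and "annihilator n mul1 = vec_span n {unit_vec n (n - 1)}"
    and "annihilator n mul2 = vec_span n {unit_vec n (n - 1)}"
    and "is_defining_matrix n mul1 \<Theta>1" and "is_defining_matrix n mul2 \<Theta>2"
    and "A \<in> carrier_mat m m" and "invertible_mat A"
    and "l \<in> {1, q}"
    and "M = four_block_mat A (0\<^sub>m m 1) (0\<^sub>m 1 m) (mat 1 1 (\<lambda>_. l))"
  shows "(\<forall>x \<in> carrier_vec n. \<forall>y \<in> carrier_vec n.
            mul1 (x \<^sub>v* M) (y \<^sub>v* M) = mul2 x y \<^sub>v* M)
         \<longleftrightarrow> A * \<Theta>1 * transpose_mat A = l \<cdot>\<^sub>m \<Theta>2"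
proof -
  have n: "n = Suc m" using assms(5,6) by simp
  note A = \<open>A \<in> carrier_mat m m\<close>
  note M = \<open>M = four_block_mat A (0\<^sub>m m 1) (0\<^sub>m 1 m) (mat 1 1 (\<lambda>_. l))\<close>
  interpret alg1: vec_algebra n mul1 by fact
  interpret alg2: vec_algebra n mul2 by fact
  interpret vec_space "TYPE('a)" n .
  let ?e = "unit_vec n m :: 'a vec"
  let ?G1 = "bordered_mat \<Theta>1" and ?G2 = "bordered_mat \<Theta>2"
  have \<Theta>1: "\<Theta>1 \<in> carrier_mat m m" and \<Theta>2: "\<Theta>2 \<in> carrier_mat m m"
    using assms(6,19,20) by (auto simp: is_defining_matrix_def)
  have Mc: "M \<in> carrier_mat n n" using A unfolding M n by auto
  have MT: "transpose_mat M \<in> carrier_mat n n" using Mc by simp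
  have G1: "?G1 \<in> carrier_mat n n" and G2: "?G2 \<in> carrier_mat n n"
    using bordered_mat_carrier \<Theta>1 \<Theta>2 n by auto
  have "?e \<in> vec_span n {?e}" by (rule span_mem) auto
  then have e1: "?e \<in> annihilator n mul1" and e2: "?e \<in> annihilator n mul2"
    using assms(6,17,18) by simp_all
  note form1 = alg1.mul_eq_bilinear_form[OF n assms(11) e1 assms(19)]
  note form2 = alg2.mul_eq_bilinear_form[OF n assms(12) e2 assms(20)]

  have lhs: "mul1 (x \<^sub>v* M) (y \<^sub>v* M) = (x \<bullet> ((M * ?G1 * transpose_mat M) *\<^sub>v y)) \<cdot>\<^sub>v ?e"
    if x: "x \<in> carrier_vec n" and y: "y \<in> carrier_vec n" for x y
  proof -
    have "mul1 (x \<^sub>v* M) (y \<^sub>v* M) =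
        ((transpose_mat M *\<^sub>v x) \<bullet> (?G1 *\<^sub>v (transpose_mat M *\<^sub>v y))) \<cdot>\<^sub>v ?e"
      using x y MT by (simp add: vec_mult_mat_eq_transpose[OF Mc] form1)
    also have "(transpose_mat M *\<^sub>v x) \<bullet> (?G1 *\<^sub>v (transpose_mat M *\<^sub>v y)) =
        x \<bullet> (M *\<^sub>v (?G1 *\<^sub>v (transpose_mat M *\<^sub>v y)))"
      using x y G1 MT by (intro transpose_vec_mult_scalar[OF Mc]) auto
    also have "M *\<^sub>v (?G1 *\<^sub>v (transpose_mat M *\<^sub>v y)) =
        (M * ?G1 * transpose_mat M) *\<^sub>v y"
      using y G1 MT Mc by (simp add: assoc_mult_mat_vec[where n\<^sub>1 = n and n\<^sub>2 = n and n\<^sub>3 = n])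
    finally show ?thesis .
  qed
  have rhs: "mul2 x y \<^sub>v* M = (x \<bullet> ((l \<cdot>\<^sub>m ?G2) *\<^sub>v y)) \<cdot>\<^sub>v ?e"
    if x: "x \<in> carrier_vec n" and y: "y \<in> carrier_vec n" for x y
  proof -
    have "mul2 x y \<^sub>v* M = transpose_mat M *\<^sub>v ((x \<bullet> (?G2 *\<^sub>v y)) \<cdot>\<^sub>v ?e)"
      using x y by (simp add: vec_mult_mat_eq_transpose[OF Mc] form2)
    also have "\<dots> = (x \<bullet> (?G2 *\<^sub>v y)) \<cdot>\<^sub>v (l \<cdot>\<^sub>v ?e)"
      using MT transpose_block_diag_mult_last_unit_vec[OF A M] n
      by (simp add: mult_mat_vec[where nr = n and nc = n])
    also have "\<dots> = (x \<bullet> (l \<cdot>\<^sub>v (?G2 *\<^sub>v y))) \<cdot>\<^sub>v ?e"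
      using x y G2 by (simp add: smult_smult_assoc mult.commute)
    also have "l \<cdot>\<^sub>v (?G2 *\<^sub>v y) = (l \<cdot>\<^sub>m ?G2) *\<^sub>v y"
      using y G2 by (intro eq_vecI) auto
    finally show ?thesis .
  qed
  have coeff: "a \<cdot>\<^sub>v ?e = b \<cdot>\<^sub>v ?e \<longleftrightarrow> a = b" for a b
  proof
    assume "a \<cdot>\<^sub>v ?e = b \<cdot>\<^sub>v ?e"
    then have "(a \<cdot>\<^sub>v ?e) $ m = (b \<cdot>\<^sub>v ?e) $ m" by simp
    then show "a = b" using n by simp
  qed simp
  have "(\<forall>x \<in> carrier_vec n. \<forall>y \<in> carrier_vec n.
            mul1 (x \<^sub>v* M) (y \<^sub>v* M) = mul2 x y \<^sub>v* M)
      \<longleftrightarrow> M * ?G1 * transpose_mat M = l \<cdot>\<^sub>m ?G2"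
    using bilinear_form_eq_iff[of "M * ?G1 * transpose_mat M" n "l \<cdot>\<^sub>m ?G2"] Mc G1 G2
    by (simp add: lhs rhs coeff)
  also have "\<dots> \<longleftrightarrow> bordered_mat (A * \<Theta>1 * transpose_mat A) = bordered_mat (l \<cdot>\<^sub>m \<Theta>2)"
    by (simp only: block_diag_congruence_bordered_mat[OF A \<Theta>1 M] smult_bordered_mat)
  also have "\<dots> \<longleftrightarrow> A * \<Theta>1 * transpose_mat A = l \<cdot>\<^sub>m \<Theta>2"
    using A \<Theta>1 \<Theta>2 by (intro bordered_mat_eq_iff) auto
  finally show ?thesis .
qed

end
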